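(* Let $X$ be a compact connected metric space with more than one point and let $f:X\to X$ be a minimal homeomorphism. Then $f$ has no shadowable points.
   Context: Let $f:X\to X$ be a homeomorphism of a metric space $(X,d)$. For $\delta>0$, a bi-infinite sequence $\xi=(\xi_n)_{n\in\mathbb{Z}}$ of points of $X$ is a $\delta$-pseudo-orbit if $d(f(\xi_n),\xi_{n+1})\leq\delta$ for all $n\in\mathbb{Z}$. For $\epsilon>0$, $\xi$ can be $\epsilon$-shadowed if there is $x\in X$ such that $d(f^n(x),\xi_n)\leq\epsilon$ for all $n\in\mathbb{Z}$. A point $x\in X$ is shadowable if for every $\epsilon>0$ there is $\delta>0$ such that every $\delta$-pseudo-orbit $\xi$ with $\xi_0=x$ can be $\epsilon$-shadowed. The homeomorphism $f$ is minimal if the orbit $\{f^n(x):n\in\mathbb{Z}\}$ of every point $x\in X$ is dense in $X$. *)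

theory Defs
  imports "HOL-Analysis.Analysis"
begin

text \<open>The metric space \<open>X\<close> is the whole type \<open>'a :: metric_space\<close>. The iterate \<open>f\<^sup>n\<close> for
  \<open>n < 0\<close> is only meaningful when \<open>f\<close> is bijective, \<open>inv f\<close> then being its inverse.\<close>

definition int_iterate :: "('a \<Rightarrow> 'a) \<Rightarrow> int \<Rightarrow> 'a \<Rightarrow> 'a" where
  "int_iterate f n = (if 0 \<le> n then f ^^ nat n else inv f ^^ nat (- n))"

definition pseudo_orbit :: "('a::metric_space \<Rightarrow> 'a) \<Rightarrow> real \<Rightarrow> (int \<Rightarrow> 'a) \<Rightarrow> bool" where
  "pseudo_orbit f \<delta> \<xi> \<longleftrightarrow> (\<forall>n. dist (f (\<xi> n)) (\<xi> (n + 1)) \<le> \<delta>)"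

definition can_be_shadowed :: "('a::metric_space \<Rightarrow> 'a) \<Rightarrow> real \<Rightarrow> (int \<Rightarrow> 'a) \<Rightarrow> bool" where
  "can_be_shadowed f \<epsilon> \<xi> \<longleftrightarrow> (\<exists>x. \<forall>n. dist (int_iterate f n x) (\<xi> n) \<le> \<epsilon>)"

definition shadowable_point :: "('a::metric_space \<Rightarrow> 'a) \<Rightarrow> 'a \<Rightarrow> bool" where
  "shadowable_point f x \<longleftrightarrow>
    (\<forall>\<epsilon>>0. \<exists>\<delta>>0. \<forall>\<xi>. pseudo_orbit f \<delta> \<xi> \<and> \<xi> 0 = x \<longrightarrow> can_be_shadowed f \<epsilon> \<xi>)"

definition minimal_homeomorphism :: "('a::metric_space \<Rightarrow> 'a) \<Rightarrow> bool" where
  "minimal_homeomorphism f \<longleftrightarrow>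
    homeomorphism UNIV UNIV f (inv f) \<and> (\<forall>x. closure (range (\<lambda>n. int_iterate f n x)) = UNIV)"

end

theory Submission
  imports Defs
begin

text \<open>
  A shadowable point \<open>x\<close> of a minimal homeomorphism \<open>f\<close> produces, for every \<open>\<epsilon>\<close>, a point \<open>y\<close> whose
  orbit under a nontrivial power \<open>f\<^sup>k\<close> stays \<open>\<epsilon>\<close>-close to \<open>x\<close>. Indeed, a connected space with more
  than one point has no isolated points, so by minimality the orbit of \<open>x\<close> comes back as close to
  \<open>x\<close> as desired at some time \<open>k \<noteq> 0\<close>; repeating the orbit segment between times \<open>0\<close> and \<open>k\<close> gives
  a \<open>k\<close>-periodic pseudo-orbit through \<open>x\<close>, and any point \<open>y\<close> shadowing it has the stated property
  (lemma \<open>shadowable_point_imp_trapped_power_orbit\<close>).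

  On the other hand all nontrivial powers of a minimal homeomorphism of a connected space are again minimal
  (lemma \<open>minimal_homeomorphism_power_orbit_dense\<close>). The orbit of \<open>y\<close> under \<open>f\<^sup>k\<close> is therefore
  dense, and the whole space lies within \<open>\<epsilon>\<close> of \<open>x\<close>. As \<open>\<epsilon>\<close> is arbitrary, the space is a single
  point.

  To see that these powers are minimal, let \<open>A\<^sub>j\<close>, for \<open>j\<close> modulo \<open>k\<close>, be the closure of the points
  \<open>f\<^sup>m(y)\<close> with \<open>m \<equiv> j\<close> modulo \<open>k\<close>. The map \<open>f\<close> permutes these sets cyclically, so the number of
  them that contain a point \<open>z\<close> is constant along orbits. It can only drop when passing from
  \<open>z\<close> to nearby points, because the sets are closed, and as every orbit is dense it must be constant
  on the whole space. Hence points near \<open>z\<close> lie in exactly the same sets \<open>A\<^sub>j\<close> as \<open>z\<close>. So each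
  \<open>A\<^sub>j\<close> is open as well as closed, and by connectedness it is everything.
\<close>

lemma int_iterate_0 [simp]: "int_iterate f 0 = id"
  by (simp add: int_iterate_def)

lemma int_iterate_succ:
  assumes "bij f"
  shows "int_iterate f (n + 1) z = f (int_iterate f n z)"
proof (cases "0 \<le> n")
  case True
  then show ?thesis
    by (simp add: int_iterate_def nat_add_distrib)
next
  case False
  define k where "k = nat (- n) - 1"
  have n: "nat (- n) = Suc k" "n = - int (Suc k)"
    using False by (auto simp: k_def)
  have "int_iterate f (n + 1) = inv f ^^ k"
    by (auto simp: int_iterate_def n(2))
  moreover have "int_iterate f n = inv f ^^ Suc k"
    using False n(1) by (simp add: int_iterate_def del: funpow.simps)
  ultimately show ?thesis
    using assms by (simp add: bij_is_surj surj_f_inv_f)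
qed

lemma int_iterate_pred:
  assumes "bij f"
  shows "int_iterate f (n - 1) z = inv f (int_iterate f n z)"
  using int_iterate_succ[OF assms, of "n - 1" z] assms
  by (simp add: bij_is_inj inv_f_f)

lemma int_iterate_add:
  assumes "bij f"
  shows "int_iterate f (m + n) z = int_iterate f m (int_iterate f n z)"
proof (induction m rule: int_induct[where k = 0])
  case base
  show ?case by simp
next
  case (step1 i)
  then show ?case
    using int_iterate_succ[OF assms, of "i + n" z] int_iterate_succ[OF assms, of i]
    by (simp add: algebra_simps)
next
  case (step2 i)
  then show ?case
    using int_iterate_pred[OF assms, of "i + n" z] int_iterate_pred[OF assms, of i]
    by (simp add: algebra_simps)
qed

lemma continuous_on_funpow:
  fixes f :: "'a::topological_space \<Rightarrow> 'a"
  assumes "continuous_on UNIV f"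
  shows "continuous_on UNIV (f ^^ n)"
proof (induction n)
  case 0
  show ?case
    by (simp add: id_def)
next
  case (Suc n)
  then show ?case
    using continuous_on_compose[of UNIV "f ^^ n" f] continuous_on_subset[OF assms] by auto
qed

lemma continuous_on_int_iterate:
  assumes "homeomorphism UNIV UNIV f (inv f)"
  shows "continuous_on UNIV (int_iterate f n)"
  using assms by (auto simp: int_iterate_def homeomorphism_def intro!: continuous_on_funpow)

lemma homeomorphism_UNIV_imp_bij:
  assumes "homeomorphism UNIV UNIV f g"
  shows "bij f"
  using assms by (auto simp: homeomorphism_def intro!: o_bij[of g f])

lemma minimal_homeomorphism_orbit_meets_open:
  assumes "minimal_homeomorphism f" "open U" "U \<noteq> {}"
  obtains n where "int_iterate f n z \<in> U"
proof -
  have "closure (range (\<lambda>n. int_iterate f n z)) = UNIV"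
    using assms(1) by (simp add: minimal_homeomorphism_def)
  then have "U \<inter> range (\<lambda>n. int_iterate f n z) \<noteq> {}"
    using open_Int_closure_eq_empty[OF assms(2)] assms(3) by fastforce
  then show thesis using that by auto
qed

text \<open>Connectedness is essential: a cyclic permutation of \<open>k > 1\<close> points is minimal, while its
  \<open>k\<close>-th power is the identity. In the proof, \<open>J z\<close> records which of the sets \<open>A j\<close> contain \<open>z\<close>,
  and connectedness enters through \<open>A 0\<close> being clopen.\<close>

lemma minimal_homeomorphism_power_orbit_dense:
  fixes f :: "'a::metric_space \<Rightarrow> 'a" and k :: int
  assumes min: "minimal_homeomorphism f"
    and conn: "connected (UNIV :: 'a set)"
    and k: "k \<noteq> 0"
  shows "closure (range (\<lambda>i. int_iterate f (i * k) y)) = UNIV"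
proof -
  have hom: "homeomorphism UNIV UNIV f (inv f)"
    using min by (simp add: minimal_homeomorphism_def)
  note bij = homeomorphism_UNIV_imp_bij[OF hom]
  define A where "A j = closure (range (\<lambda>i. int_iterate f (i * k + j) y))" for j
  define residues where "residues = {0..<\<bar>k\<bar>}"
  define J where "J z = {j \<in> residues. z \<in> A j}" for z
  have finJ: "finite (J z)" for z
    unfolding J_def residues_def by (rule finite_subset[of _ "{0..<\<bar>k\<bar>}"]) auto

  have A_shift: "A (j + l * k) = A j" for j l
  proof -
    have "range (\<lambda>i. int_iterate f (i * k + (j + l * k)) y) = range (\<lambda>i. int_iterate f (i * k + j) y)"
      (is "range ?F = range ?G")
    proof -
      have "?F i \<in> range ?G" for i
        using rangeI[of ?G "i + l"] by (simp add: algebra_simps)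
      moreover have "?G i \<in> range ?F" for i
        using rangeI[of ?F "i - l"] by (simp add: algebra_simps)
      ultimately show ?thesis by (intro equalityI image_subsetI)
    qed
    then show ?thesis by (simp add: A_def)
  qed
  have A_mod: "A (j mod \<bar>k\<bar>) = A j" for j
  proof -
    have "j mod \<bar>k\<bar> = j + (- (j div \<bar>k\<bar>) * sgn k) * k"
      using div_mult_mod_eq[of j "\<bar>k\<bar>"] by (simp add: abs_sgn[of k] algebra_simps)
    then show ?thesis by (simp only: A_shift)
  qed
  have A_iterate: "int_iterate f m z \<in> A (j + m)" if "z \<in> A j" for m z j
  proof -
    have "int_iterate f m ` range (\<lambda>i. int_iterate f (i * k + j) y) \<subseteq> A (j + m)"
    proof clarify
      fix i
      have "int_iterate f m (int_iterate f (i * k + j) y) = int_iterate f (i * k + (j + m)) y"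
        by (simp add: int_iterate_add[OF bij, symmetric] algebra_simps)
      then show "int_iterate f m (int_iterate f (i * k + j) y) \<in> A (j + m)"
        unfolding A_def by (auto intro: subsetD[OF closure_subset])
    qed
    then have "int_iterate f m ` A j \<subseteq> A (j + m)"
      using image_closure_subset[OF continuous_on_subset[OF continuous_on_int_iterate[OF hom]], of _ "A (j + m)" m]
      by (auto simp: A_def)
    then show ?thesis using that by blast
  qed

  \<comment> \<open>The shift \<open>j \<mapsto> j + m\<close> of residues embeds \<open>J z\<close> into \<open>J (f\<^sup>m z)\<close>.\<close>
  have card_orbit: "card (J z) \<le> card (J (int_iterate f m z))" for z m
  proof (rule card_inj_on_le[where f = "\<lambda>j. (j + m) mod \<bar>k\<bar>"])
    show "inj_on (\<lambda>j. (j + m) mod \<bar>k\<bar>) (J z)"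
    proof (rule inj_onI)
      fix i j assume ij: "i \<in> J z" "j \<in> J z" "(i + m) mod \<bar>k\<bar> = (j + m) mod \<bar>k\<bar>"
      then have "((i + m) - m) mod \<bar>k\<bar> = ((j + m) - m) mod \<bar>k\<bar>"
        by (metis mod_diff_left_eq)
      then show "i = j" using ij(1,2) by (simp add: J_def residues_def)
    qed
    show "(\<lambda>j. (j + m) mod \<bar>k\<bar>) ` J z \<subseteq> J (int_iterate f m z)"
      using k by (auto simp: J_def residues_def A_mod A_iterate)
  qed (rule finJ)

  have J_nbhd: "\<exists>U. open U \<and> z \<in> U \<and> (\<forall>w\<in>U. J w \<subseteq> J z)" for z
  proof (intro exI conjI)
    show "open (\<Inter>j\<in>residues - J z. - A j)"
      by (auto simp: residues_def A_def)
  qed (auto simp: J_def)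

  \<comment> \<open>Move \<open>z\<close> along its orbit, where the count does not decrease, to a point so close to \<open>w\<close>
    that it lies in no \<open>A j\<close> missing \<open>w\<close>. As \<open>z\<close> and \<open>w\<close> are arbitrary, the count is constant.\<close>
  have card_le: "card (J z) \<le> card (J w)" for z w
  proof -
    obtain U where U: "open U" "w \<in> U" "\<forall>v\<in>U. J v \<subseteq> J w"
      using J_nbhd by blast
    obtain n where "int_iterate f n z \<in> U"
      using minimal_homeomorphism_orbit_meets_open[OF min U(1)] U(2) by blast
    then have "card (J (int_iterate f n z)) \<le> card (J w)"
      using U(3) finJ by (simp add: card_mono)
    with card_orbit show ?thesis using order_trans by blast
  qed

  have "open (A 0)"
  proof (subst open_subopen, intro ballI)
    fix z assume z: "z \<in> A 0"
    obtain U where U: "open U" "z \<in> U" "\<forall>w\<in>U. J w \<subseteq> J z"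
      using J_nbhd by blast
    have "w \<in> A 0" if "w \<in> U" for w
    proof -
      have "J w = J z"
        using card_seteq[OF finJ, of "J w" z] U(3) that card_le by blast
      moreover have "0 \<in> J z"
        using z k by (simp add: J_def residues_def)
      ultimately show ?thesis by (auto simp: J_def)
    qed
    then show "\<exists>T. open T \<and> z \<in> T \<and> T \<subseteq> A 0" using U by blast
  qed
  moreover have "closed (A 0)" "A 0 \<noteq> {}"
    by (auto simp: A_def)
  ultimately have "A 0 = UNIV"
    using conn by (auto simp: connected_clopen)
  then show ?thesis by (simp add: A_def)
qed

text \<open>The return time given by minimality may have either sign. The pseudo-orbit is therefore
  written with the signed remainder \<open>i mod k\<close>, which ranges over \<open>0, \<dots>, k - 1\<close> for \<open>k > 0\<close> and over
  \<open>k + 1, \<dots>, 0\<close> for \<open>k < 0\<close>. Its only jumps are from \<open>f\<^sup>k(x)\<close> to \<open>x\<close> in the first case and from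
  \<open>f(x)\<close> to \<open>f(f\<^sup>k(x))\<close> in the second, which is why the return is required to be close both before
  and after applying \<open>f\<close>.\<close>

lemma periodic_pseudo_orbit:
  fixes k :: int
  assumes bij: "bij f" and k: "k \<noteq> 0" and \<delta>: "\<delta> \<ge> 0"
    and ret: "dist (int_iterate f k x) x \<le> \<delta>" "dist (f (int_iterate f k x)) (f x) \<le> \<delta>"
  shows "pseudo_orbit f \<delta> (\<lambda>i. int_iterate f (i mod k) x)"
  unfolding pseudo_orbit_def
proof
  fix i :: int
  define r where "r = i mod k"
  have succ: "f (int_iterate f r x) = int_iterate f (r + 1) x"
    by (simp add: int_iterate_succ[OF bij])
  have mod: "(i + 1) mod k = (r + 1) mod k"
    by (simp add: r_def mod_add_left_eq)
  consider "(r + 1) mod k = r + 1" | "k > 0" "r + 1 = k" | "k < 0" "r = 0"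
  proof -
    have "(r + 1) mod k = r + 1" if "k > 0" "r + 1 \<noteq> k"
      using that pos_mod_bound[of k i] pos_mod_sign[of k i]
      unfolding r_def by (intro mod_pos_pos_trivial) linarith+
    moreover have "(r + 1) mod k = r + 1" if "k < 0" "r \<noteq> 0"
      using that neg_mod_bound[of k i] neg_mod_sign[of k i]
      unfolding r_def by (intro mod_neg_neg_trivial) linarith+
    ultimately show thesis using k that by linarith
  qed
  then show "dist (f (int_iterate f (i mod k) x)) (int_iterate f ((i + 1) mod k) x) \<le> \<delta>"
    unfolding mod r_def[symmetric]
  proof cases
    case 1
    then show "dist (f (int_iterate f r x)) (int_iterate f ((r + 1) mod k) x) \<le> \<delta>"
      using \<delta> succ by simp
  next
    case 2
    then show "dist (f (int_iterate f r x)) (int_iterate f ((r + 1) mod k) x) \<le> \<delta>"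
      using ret(1) succ by simp
  next
    case 3
    have "1 mod k = k + 1"
      using 3 mod_pos_neg_trivial[of 1 k] by simp
    then show "dist (f (int_iterate f r x)) (int_iterate f ((r + 1) mod k) x) \<le> \<delta>"
      using ret(2) 3 by (simp add: int_iterate_succ[OF bij] dist_commute)
  qed
qed

lemma minimal_homeomorphism_returns:
  fixes f :: "'a::metric_space \<Rightarrow> 'a"
  assumes min: "minimal_homeomorphism f"
    and conn: "connected (UNIV :: 'a set)" and nontriv: "\<exists>x y :: 'a. x \<noteq> y"
    and U: "open U" "x \<in> U"
  obtains k where "k \<noteq> 0" "int_iterate f k x \<in> U"
proof -
  have "x islimpt UNIV"
    using connected_imp_perfect[OF conn, of x] nontriv by (metis UNIV_I singletonD)
  then have "U - {x} \<noteq> {}"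
    using U by (auto simp: islimpt_def)
  moreover have "open (U - {x})" using U(1) by auto
  ultimately obtain k where "int_iterate f k x \<in> U - {x}"
    using minimal_homeomorphism_orbit_meets_open[OF min] by metis
  moreover from this have "k \<noteq> 0" by auto
  ultimately show thesis using that by blast
qed

lemma shadowable_point_imp_trapped_power_orbit:
  fixes f :: "'a::metric_space \<Rightarrow> 'a"
  assumes min: "minimal_homeomorphism f"
    and conn: "connected (UNIV :: 'a set)" and nontriv: "\<exists>x y :: 'a. x \<noteq> y"
    and x: "shadowable_point f x" and "\<epsilon> > 0"
  obtains k y where "k \<noteq> 0" "\<And>i. dist (int_iterate f (i * k) y) x \<le> \<epsilon>"
proof -
  have hom: "homeomorphism UNIV UNIV f (inv f)"
    using min by (simp add: minimal_homeomorphism_def)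
  obtain \<delta> where \<delta>: "\<delta> > 0"
    "\<And>\<xi>. pseudo_orbit f \<delta> \<xi> \<Longrightarrow> \<xi> 0 = x \<Longrightarrow> can_be_shadowed f \<epsilon> \<xi>"
    using x \<open>\<epsilon> > 0\<close> by (auto simp: shadowable_point_def)
  define U where "U = ball x \<delta> \<inter> f -` ball (f x) \<delta>"
  have "open U"
    using hom by (auto simp: U_def homeomorphism_def intro!: open_vimage)
  moreover have "x \<in> U" using \<delta>(1) by (simp add: U_def)
  ultimately obtain k where k: "k \<noteq> 0" "int_iterate f k x \<in> U"
    using minimal_homeomorphism_returns[OF min conn nontriv] by blast
  have "pseudo_orbit f \<delta> (\<lambda>i. int_iterate f (i mod k) x)"
    using k \<delta>(1) homeomorphism_UNIV_imp_bij[OF hom]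
    by (intro periodic_pseudo_orbit) (auto simp: U_def dist_commute)
  then obtain y where y: "\<And>n. dist (int_iterate f n y) (int_iterate f (n mod k) x) \<le> \<epsilon>"
    using \<delta>(2) by (force simp: can_be_shadowed_def)
  have "dist (int_iterate f (i * k) y) x \<le> \<epsilon>" for i
    using y[of "i * k"] by simp
  with k(1) show thesis using that by blast
qed

theorem theorem1p4:
  fixes f :: "'a::metric_space \<Rightarrow> 'a"
  assumes "compact (UNIV :: 'a set)"
    and "connected (UNIV :: 'a set)"
    and "\<exists>x y :: 'a. x \<noteq> y"
    and "minimal_homeomorphism f"
  shows "\<not> (\<exists>x. shadowable_point f x)"
proof
  assume "\<exists>x. shadowable_point f x"
  then obtain x where x: "shadowable_point f x" by blast
  obtain a where "a \<noteq> x" using assms(3) by metis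
  define \<epsilon> where "\<epsilon> = dist a x / 2"
  have \<epsilon>: "\<epsilon> > 0" "\<epsilon> < dist a x" using \<open>a \<noteq> x\<close> by (auto simp: \<epsilon>_def)
  obtain k y where k: "k \<noteq> 0" and y: "\<And>i. dist (int_iterate f (i * k) y) x \<le> \<epsilon>"
    using shadowable_point_imp_trapped_power_orbit[OF assms(4,2,3) x \<epsilon>(1)] by blast
  have "closure (range (\<lambda>i. int_iterate f (i * k) y)) \<subseteq> cball x \<epsilon>"
    using y by (intro closure_minimal) (auto simp: dist_commute)
  then have "a \<in> cball x \<epsilon>"
    using minimal_homeomorphism_power_orbit_dense[OF assms(4,2) k, of y] by blast
  then show False using \<epsilon>(2) by (simp add: dist_commute)
qed

end
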